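(* Let $p$ and $q$ be prime numbers with $p>5$ and $q>5$, let $E_{(p,q)}$ be the elliptic curve over $\mathbb{Q}$ given by $y^2=x^3-p^2x+q^2$, and let $P_1=(0,q)$ and $P_2=(-p,q)$ in $E_{(p,q)}(\mathbb{Q})$. If $p>2\sqrt[4]{2}\,q$, then \[\hat{h}(P_1)\leqslant \frac{1}{2}\log(p)+\frac{1}{24}\log(2^{11}p^4),\qquad \hat{h}(P_2)\leqslant \frac{1}{2}\log(p)+\frac{1}{6}\log(2^{11}p^4).\]
   Context: $\hat h$ denotes the canonical height on $E_{(p,q)}(\mathbb{Q})$, defined by $\hat h(\mathcal O)=0$ and $\hat h(P)=\lim_{n\to\infty}4^{-n}h(2^nP)$ for $P\neq\mathcal O$, where $h$ is the naive height $h(P)=\frac12\log\max(|a|,|b|)$ for $x(P)=a/b$ in lowest terms; with this normalization $\hat h(P)=\hat\lambda_\infty(P)+\sum_{r\mid\Delta}\hat\lambda_r(P)$ is the sum of the archimedean local height and the non-archimedean local heights at the primes $r$ dividing the discriminant $\Delta=16(4p^6-27q^4)$, as in Silverman's "Computing heights on elliptic curves". *)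

theory Defs
  imports Complex_Main "HOL-Computational_Algebra.Primes"
begin

datatype 'a point = Infinity | Affine 'a 'a

text \<open>
  The pair \<open>A\<close>, \<open>B\<close> stands for the short Weierstrass equation
  \<open>y\<^sup>2 = x\<^sup>3 + A x + B\<close>; it defines an elliptic curve iff its discriminant is nonzero.
\<close>

definition discriminant :: "'a::field \<Rightarrow> 'a \<Rightarrow> 'a" where
  "discriminant A B = - 16 * (4 * A ^ 3 + 27 * B ^ 2)"

definition curve_points :: "'a::field \<Rightarrow> 'a \<Rightarrow> 'a point set" where
  "curve_points A B = insert Infinity {Affine x y | x y. y ^ 2 = x ^ 3 + A * x + B}"

definition slope :: "'a::field \<Rightarrow> 'a \<Rightarrow> 'a \<Rightarrow> 'a \<Rightarrow> 'a \<Rightarrow> 'a" where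
  "slope A x1 y1 x2 y2 =
     (if x1 = x2 then (3 * x1 ^ 2 + A) / (2 * y1) else (y2 - y1) / (x2 - x1))"

text \<open>
  The chord-tangent law. For points on a common curve it does not need \<open>B\<close>. The condition
  \<open>x1 = x2 \<and> y1 = - y2\<close> covers both a point plus its inverse and the doubling of a
  point of order two.
\<close>

fun point_add :: "'a::field \<Rightarrow> 'a point \<Rightarrow> 'a point \<Rightarrow> 'a point" where
  "point_add A Infinity Q = Q"
| "point_add A P Infinity = P"
| "point_add A (Affine x1 y1) (Affine x2 y2) =
     (if x1 = x2 \<and> y1 = - y2 then Infinity
      else let m = slope A x1 y1 x2 y2; x3 = m ^ 2 - x1 - x2
           in Affine x3 (m * (x1 - x3) - y1))"

primrec point_mult :: "'a::field \<Rightarrow> nat \<Rightarrow> 'a point \<Rightarrow> 'a point" where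
  "point_mult A 0 P = Infinity"
| "point_mult A (Suc n) P = point_add A P (point_mult A n P)"

text \<open>
  The value at \<open>Infinity\<close> is the usual convention; it is needed since a multiple of a torsion
  point can be \<open>Infinity\<close>.
\<close>

fun naive_height :: "rat point \<Rightarrow> real" where
  "naive_height Infinity = 0"
| "naive_height (Affine x y) =
     (let (a, b) = quotient_of x in 1 / 2 * ln (real_of_int (max \<bar>a\<bar> \<bar>b\<bar>)))"

definition canonical_height :: "rat \<Rightarrow> rat point \<Rightarrow> real" where
  "canonical_height A P =
     (if P = Infinity then 0
      else lim (\<lambda>n. naive_height (point_mult A (2 ^ n) P) / 4 ^ n))"

text \<open>The curve \<open>y\<^sup>2 = x\<^sup>3 - p\<^sup>2 x + q\<^sup>2\<close>.\<close>

definition coeff_A :: "nat \<Rightarrow> rat" where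
  "coeff_A p = - (of_nat p ^ 2)"

definition coeff_B :: "nat \<Rightarrow> rat" where
  "coeff_B q = of_nat q ^ 2"

definition P1 :: "nat \<Rightarrow> rat point" where
  "P1 q = Affine 0 (of_nat q)"

definition P2 :: "nat \<Rightarrow> nat \<Rightarrow> rat point" where
  "P2 p q = Affine (- of_nat p) (of_nat q)"

lemma P1_in_curve: "P1 q \<in> curve_points (coeff_A p) (coeff_B q)"
  by (simp add: P1_def curve_points_def coeff_A_def coeff_B_def)

lemma P2_in_curve: "P2 p q \<in> curve_points (coeff_A p) (coeff_B q)"
  by (simp add: P2_def curve_points_def coeff_A_def coeff_B_def power2_eq_square power3_eq_cube)

lemma discriminant_eq:
  "discriminant (coeff_A p) (coeff_B q) = 16 * (4 * of_nat p ^ 6 - 27 * of_nat q ^ 4)"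
  by (simp add: discriminant_def coeff_A_def coeff_B_def flip: power_mult)

lemma discriminant_nonzero:
  assumes "prime q" "q > 5"
  shows "discriminant (coeff_A p) (coeff_B q) \<noteq> 0"
proof
  assume "discriminant (coeff_A p) (coeff_B q) = 0"
  then have "(of_nat (4 * p ^ 6) :: rat) = of_nat (27 * q ^ 4)"
    by (simp add: discriminant_eq)
  then have "4 * p ^ 6 = 27 * q ^ 4"
    by (simp only: of_nat_eq_iff)
  moreover have "odd q"
    using assms prime_odd_nat by auto
  then have "odd (27 * q ^ 4)" by simp
  moreover have "even (4 * p ^ 6)" by simp
  ultimately show False by metis
qed

lemma point_add_in_curve:
  fixes A B :: "'a::field_char_0"
  assumes "P \<in> curve_points A B" "Q \<in> curve_points A B"
  shows "point_add A P Q \<in> curve_points A B"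
proof (cases "P = Infinity \<or> Q = Infinity")
  case True
  then show ?thesis using assms by (cases P; cases Q) auto
next
  case False
  then obtain x1 y1 x2 y2 where P: "P = Affine x1 y1" and Q: "Q = Affine x2 y2"
    by (metis point.exhaust)
  have e1: "y1 ^ 2 = x1 ^ 3 + A * x1 + B" and e2: "y2 ^ 2 = x2 ^ 3 + A * x2 + B"
    using assms unfolding P Q curve_points_def by auto
  show ?thesis
  proof (cases "x1 = x2 \<and> y1 = - y2")
    case True
    then show ?thesis unfolding P Q by (simp add: curve_points_def)
  next
    case ne: False
    define m where "m = slope A x1 y1 x2 y2"
    define x3 where "x3 = m ^ 2 - x1 - x2"
    define y3 where "y3 = m * (x1 - x3) - y1"
    have "y3 ^ 2 = x3 ^ 3 + A * x3 + B"
    proof (cases "x1 = x2")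
      case True
      then have "(y1 - y2) * (y1 + y2) = 0"
        using e1 e2 by (simp add: algebra_simps power2_eq_square)
      then have y: "y1 = y2" and "y1 \<noteq> 0"
        using ne True by (auto simp: eq_neg_iff_add_eq_0)
      then have "m * (2 * y1) = 3 * x1 ^ 2 + A"
        using True by (simp add: m_def slope_def)
      then show ?thesis using e1 True unfolding y3_def x3_def by algebra
    next
      case False
      then have m: "m * (x2 - x1) = y2 - y1"
        by (simp add: m_def slope_def)
      have "(x2 - x1) * (y3 ^ 2 - (x3 ^ 3 + A * x3 + B)) = 0"
        using e1 e2 m unfolding y3_def x3_def by algebra
      then show ?thesis using False by simp
    qed
    then show ?thesis
      using ne unfolding P Q by (auto simp: curve_points_def Let_def m_def x3_def y3_def)
  qed
qed

end

theory Submission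
  imports Defs "HOL-Computational_Algebra.Polynomial"
begin

text \<open>
  Doubling is given on \<open>x\<close>-coordinates by quartic forms, so \<open>h(2P) \<le> 4 h(P) + c\<close> with
  \<open>c = log(2\<^sup>1\<^sup>1 p\<^sup>4) / 2\<close>. Hence \<open>(h(2\<^sup>n P) + c/3) / 4\<^sup>n\<close> is decreasing and nonnegative; it
  converges to the canonical height, which is therefore bounded by each of its terms. The term
  \<open>n = 0\<close> gives the bound for \<open>P\<^sub>2\<close>, and \<open>n = 1\<close> the bound for \<open>P\<^sub>1\<close>, as
  \<open>x(2P\<^sub>1) = p\<^sup>4 / (4q\<^sup>2)\<close>.

  That \<open>2\<^sup>n\<^sup>+\<^sup>1 P\<close> is the double of \<open>2\<^sup>n P\<close> requires associativity. Write \<open>S\<close> for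
  \<open>-((P + Q) + R)\<close>. Multiplying the lines through \<open>P, Q\<close> and through \<open>P + Q, R\<close> and cancelling
  the vertical line at \<open>P + Q\<close> yields a function \<open>\<alpha> y + u(x)\<close> vanishing at \<open>P, Q, R, S\<close>.
  That condition is symmetric in the four points, and dividing by the line through \<open>Q, R\<close>
  instead shows that \<open>Q + R\<close>, \<open>P\<close>, \<open>S\<close> are collinear. Stating incidence through the
  factorization of norms covers tangency without case distinctions.
\<close>

section \<open>Collinear triples and the chord-tangent law\<close>

fun opp :: "'a::field point \<Rightarrow> 'a point" where
  "opp Infinity = Infinity"
| "opp (Affine x y) = Affine x (- y)"

lemma opp_opp [simp]: "opp (opp P) = P"
  by (cases P) auto

lemma opp_in_curve: "P \<in> curve_points A B \<Longrightarrow> opp P \<in> curve_points A B"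
  by (cases P) (auto simp: curve_points_def)

definition weierstrass :: "'a::field \<Rightarrow> 'a \<Rightarrow> 'a poly" where
  "weierstrass A B = [:B, A, 0, 1:]"

text \<open>On the line \<open>y = l(x)\<close> the curve equation becomes
  \<open>f - l^2 = 0\<close>, so the factorization lists the intersection points with multiplicity.
  Vertical lines are not of this form.\<close>

definition collinear_at :: "'a::field \<Rightarrow> 'a \<Rightarrow> 'a poly \<Rightarrow> 'a \<Rightarrow> 'a \<Rightarrow> 'a \<Rightarrow> bool" where
  "collinear_at A B l x1 x2 x3 \<longleftrightarrow> degree l \<le> 1 \<and>
     weierstrass A B - l ^ 2 = [:- x1, 1:] * [:- x2, 1:] * [:- x3, 1:]"

text \<open>The divisor P + Q + R - 3O is that of a line. The clauses with \<open>Infinity\<close>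
  are the vertical lines and the line at infinity.\<close>

fun sum_zero :: "'a::field \<Rightarrow> 'a \<Rightarrow> 'a point \<Rightarrow> 'a point \<Rightarrow> 'a point \<Rightarrow> bool" where
  "sum_zero A B Infinity Q R \<longleftrightarrow> R = opp Q"
| "sum_zero A B P Infinity R \<longleftrightarrow> R = opp P"
| "sum_zero A B P Q Infinity \<longleftrightarrow> Q = opp P"
| "sum_zero A B (Affine x1 y1) (Affine x2 y2) (Affine x3 y3) \<longleftrightarrow>
     (\<exists>l. collinear_at A B l x1 x2 x3 \<and> y1 = poly l x1 \<and> y2 = poly l x2 \<and> y3 = poly l x3)"

text \<open>Vieta's formulas for the monic cubic \<open>f - l^2\<close>, turning incidence into
  polynomial identities.\<close>

lemma collinear_at_iff:
  "collinear_at A B [:c, m:] x1 x2 x3 \<longleftrightarrow>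
     x1 + x2 + x3 = m ^ 2 \<and> x1 * x2 + x1 * x3 + x2 * x3 = A - 2 * m * c \<and>
     x1 * x2 * x3 = c ^ 2 - B"
proof -
  have "collinear_at A B [:c, m:] x1 x2 x3 \<longleftrightarrow>
     B - c * c = - (x1 * x2 * x3) \<and> A - (c * m + m * c) = x1 * x2 + (x1 + x2) * x3 \<and>
     - (m * m) = - (x1 + x2 + x3)"
    unfolding collinear_at_def weierstrass_def
    by (simp add: power2_eq_square algebra_simps)
  also have "\<dots> \<longleftrightarrow> x1 + x2 + x3 = m ^ 2 \<and> x1 * x2 + x1 * x3 + x2 * x3 = A - 2 * m * c \<and>
     x1 * x2 * x3 = c ^ 2 - B"
    by (auto simp: power2_eq_square algebra_simps)
  finally show ?thesis .
qed

lemma degree_le_1E: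
  assumes "degree (l :: 'a::field poly) \<le> 1"
  obtains c m where "l = [:c, m:]"
proof -
  have "l = [:coeff l 0, coeff l 1:]"
    using assms by (intro poly_eqI) (auto simp: coeff_pCons coeff_eq_0 split: nat.splits)
  then show ?thesis using that by blast
qed

lemma collinear_at_perm:
  "collinear_at A B l x1 x2 x3 \<longleftrightarrow> collinear_at A B l x2 x1 x3"
  "collinear_at A B l x1 x2 x3 \<longleftrightarrow> collinear_at A B l x1 x3 x2"
  unfolding collinear_at_def by (simp_all only: mult_ac)

lemma sum_zero_perm:
  "sum_zero A B P Q R \<longleftrightarrow> sum_zero A B Q P R"
  "sum_zero A B P Q R \<longleftrightarrow> sum_zero A B P R Q"
  by (cases P; cases Q; cases R; auto simp: collinear_at_perm)+

lemma sum_zero_opp: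
  assumes "sum_zero A B P Q R"
  shows "sum_zero A B (opp P) (opp Q) (opp R)"
proof (cases "P = Infinity \<or> Q = Infinity \<or> R = Infinity")
  case True
  then show ?thesis using assms by (cases P; cases Q; cases R) auto
next
  case False
  then obtain x1 y1 x2 y2 x3 y3
    where e: "P = Affine x1 y1" "Q = Affine x2 y2" "R = Affine x3 y3"
    by (metis point.exhaust)
  from assms obtain l where "collinear_at A B l x1 x2 x3"
    "y1 = poly l x1" "y2 = poly l x2" "y3 = poly l x3"
    unfolding e by auto
  then have "collinear_at A B (- l) x1 x2 x3 \<and>
      - y1 = poly (- l) x1 \<and> - y2 = poly (- l) x2 \<and> - y3 = poly (- l) x3"
    by (auto simp: collinear_at_def)
  then show ?thesis unfolding e by auto
qed

lemma nonsingular: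
  fixes A B :: "'a::field"
  assumes "discriminant A B \<noteq> 0" "x ^ 3 + A * x + B = 0"
  shows "3 * x ^ 2 + A \<noteq> 0"
proof
  assume "3 * x ^ 2 + A = 0"
  with assms(2) have "4 * A ^ 3 + 27 * B ^ 2 = 0"
    by algebra
  then show False using assms(1) by (simp add: discriminant_def)
qed

text \<open>The choice of \<open>x3\<close> is Vieta's relation for the sum of the roots. The other
  two relations follow from the curve equations: for a chord after multiplying by
  \<open>x2 - x1\<close>, for a tangent from the equation of the slope.\<close>

lemma sum_zero_add:
  fixes A B :: "'a::field_char_0"
  assumes "P \<in> curve_points A B" "Q \<in> curve_points A B"
  shows "sum_zero A B P Q (opp (point_add A P Q))"
proof (cases "P = Infinity \<or> Q = Infinity")
  case True
  then show ?thesis by (cases P; cases Q) auto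
next
  case False
  then obtain x1 y1 x2 y2 where P: "P = Affine x1 y1" and Q: "Q = Affine x2 y2"
    by (metis point.exhaust)
  have e1: "y1 ^ 2 = x1 ^ 3 + A * x1 + B" and e2: "y2 ^ 2 = x2 ^ 3 + A * x2 + B"
    using assms unfolding P Q curve_points_def by auto
  show ?thesis
  proof (cases "x1 = x2 \<and> y1 = - y2")
    case True
    then show ?thesis unfolding P Q by auto
  next
    case ne: False
    define m where "m = slope A x1 y1 x2 y2"
    define x3 where "x3 = m ^ 2 - x1 - x2"
    define c where "c = y1 - m * x1"
    have *: "x1 * x2 + x1 * x3 + x2 * x3 = A - 2 * m * c \<and> x1 * x2 * x3 = c ^ 2 - B \<and>
        y2 = c + x2 * m"
    proof (cases "x1 = x2")
      case True
      then have "(y1 - y2) * (y1 + y2) = 0"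
        using e1 e2 by (simp add: algebra_simps power2_eq_square)
      then have y: "y1 = y2" and "y1 \<noteq> 0"
        using ne True by (auto simp: eq_neg_iff_add_eq_0)
      then have m: "m * (2 * y1) = 3 * x1 ^ 2 + A"
        using True by (simp add: m_def slope_def)
      have "x1 * x1 + x1 * x3 + x1 * x3 = A - 2 * m * c"
        using m unfolding c_def x3_def True by algebra
      moreover have "x1 * x1 * x3 = c ^ 2 - B"
        using m e1 unfolding c_def x3_def True by algebra
      ultimately show ?thesis using True y by (simp add: c_def)
    next
      case False
      then have m: "m * (x2 - x1) = y2 - y1"
        by (simp add: m_def slope_def)
      then have y2: "y2 = c + x2 * m" by (simp add: c_def algebra_simps)
      have "(x2 - x1) * (x1 * x2 + x1 * x3 + x2 * x3 - (A - 2 * m * c)) = 0"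
        using e1 e2 m unfolding c_def x3_def by algebra
      moreover have "(x2 - x1) * (x1 * x2 * x3 - (c ^ 2 - B)) = 0"
        using e1 e2 m unfolding c_def x3_def by algebra
      ultimately show ?thesis using False y2 by simp
    qed
    have "collinear_at A B [:c, m:] x1 x2 x3"
      using * by (simp add: collinear_at_iff x3_def)
    moreover have "y1 = poly [:c, m:] x1" "y2 = poly [:c, m:] x2"
      using * by (simp_all add: c_def)
    moreover have "- (m * (x1 - x3) - y1) = poly [:c, m:] x3"
      by (simp add: c_def algebra_simps)
    moreover have "point_add A P Q = Affine x3 (m * (x1 - x3) - y1)"
      using ne unfolding P Q by (simp add: Let_def m_def x3_def)
    ultimately show ?thesis unfolding P Q by auto
  qed
qed

text \<open>Converse of \<open>sum_zero_add\<close>: the line must be the one that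
  \<open>slope\<close> computes. Together they translate between addition and the symmetric relation
  \<open>sum_zero\<close>.\<close>

lemma sum_zero_unique:
  fixes A B :: "'a::field_char_0"
  assumes d: "discriminant A B \<noteq> 0" and s: "sum_zero A B P Q R"
    and c: "P \<in> curve_points A B" "Q \<in> curve_points A B"
  shows "point_add A P Q = opp R"
proof (cases "P = Infinity \<or> Q = Infinity \<or> R = Infinity")
  case True
  then show ?thesis using s by (cases P; cases Q; cases R) auto
next
  case False
  then obtain x1 y1 x2 y2 x3 y3
    where e: "P = Affine x1 y1" "Q = Affine x2 y2" "R = Affine x3 y3"
    by (metis point.exhaust)
  have e1: "y1 ^ 2 = x1 ^ 3 + A * x1 + B"
    using c unfolding e curve_points_def by auto
  from s obtain l where l: "collinear_at A B l x1 x2 x3"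
    "y1 = poly l x1" "y2 = poly l x2" "y3 = poly l x3"
    unfolding e by auto
  then obtain c m where cm: "l = [:c, m:]"
    using degree_le_1E unfolding collinear_at_def by blast
  have y: "y1 = c + m * x1" "y2 = c + m * x2" "y3 = c + m * x3"
    using l by (simp_all add: cm)
  have v: "x1 + x2 + x3 = m ^ 2" "x1 * x2 + x1 * x3 + x2 * x3 = A - 2 * m * c"
    using l(1) unfolding cm collinear_at_iff by auto
  have sl: "\<not> (x1 = x2 \<and> y1 = - y2) \<and> slope A x1 y1 x2 y2 = m"
  proof (cases "x1 = x2")
    case True
    have m: "3 * x1 ^ 2 + A = m * (2 * y1)"
      using v unfolding y True by algebra
    \<comment> \<open>With \<open>y1 = 0\<close> the tangent relation would make \<open>x1\<close> a
      root of both the cubic and its derivative, contradicting smoothness.\<close>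
    then have "y1 \<noteq> 0"
      using e1 nonsingular[OF d, of x1] by auto
    moreover from this have "m = (3 * x1 ^ 2 + A) / (2 * y1)"
      by (subst nonzero_eq_divide_eq) (simp_all add: m)
    moreover have "y2 = y1" using y True by simp
    ultimately show ?thesis using True by (simp add: slope_def)
  next
    case False
    then show ?thesis by (simp add: slope_def y divide_eq_eq algebra_simps)
  qed
  have x3: "m ^ 2 - x1 - x2 = x3" using v by algebra
  have "m * (x1 - x3) - y1 = - y3" unfolding y by algebra
  then show ?thesis
    unfolding e by (simp only: point_add.simps opp.simps Let_def conjunct1[OF sl] conjunct2[OF sl] x3 if_False)
qed

lemma point_add_comm:
  fixes A B :: "'a::field_char_0"
  assumes "discriminant A B \<noteq> 0" "P \<in> curve_points A B" "Q \<in> curve_points A B"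
  shows "point_add A P Q = point_add A Q P"
  using sum_zero_unique[OF assms(1) sum_zero_perm(1)[THEN iffD1, OF sum_zero_add]] assms by simp

text \<open>Reflecting the collinear triple P, Q, -(P + Q) and permuting it shows that P + Q, -Q, -P
  are collinear. This case of associativity settles the degenerate configurations later.\<close>

lemma point_add_opp_cancel:
  fixes A B :: "'a::field_char_0"
  assumes d: "discriminant A B \<noteq> 0" and c: "P \<in> curve_points A B" "Q \<in> curve_points A B"
  shows "point_add A (point_add A P Q) (opp Q) = P"
proof -
  have "sum_zero A B (opp P) (opp Q) (point_add A P Q)"
    using sum_zero_opp[OF sum_zero_add[OF c]] by simp
  then have "sum_zero A B (point_add A P Q) (opp Q) (opp P)"
    by (metis sum_zero_perm)
  from sum_zero_unique[OF d this] show ?thesis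
    using c by (simp add: point_add_in_curve opp_in_curve)
qed

section \<open>Associativity through functions with four zeros\<close>

text \<open>
  The function \<open>\<alpha> y + u\<close> has divisor \<open>P\<^sub>1 + P\<^sub>2 + P\<^sub>3 + P\<^sub>4 - 4 O\<close>. Its norm
  \<open>u\<^sup>2 - \<alpha>\<^sup>2 f\<close> determines the multiplicities only if \<open>\<alpha> \<noteq> 0\<close>: a function of \<open>x\<close> alone
  cannot tell a double zero at \<open>P\<close> from zeros at \<open>P\<close> and \<open>-P\<close>.
\<close>

definition quad :: "'a::field \<Rightarrow> 'a \<Rightarrow> 'a \<Rightarrow> 'a poly \<Rightarrow> 'a \<times> 'a \<Rightarrow> 'a \<times> 'a \<Rightarrow> 'a \<times> 'a \<Rightarrow> 'a \<times> 'a \<Rightarrow> bool" where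
  "quad A B \<alpha> u v1 v2 v3 v4 \<longleftrightarrow> \<alpha> \<noteq> 0 \<and> degree u = 2 \<and> lead_coeff u = 1 \<and>
     (\<forall>(x, y) \<in> {v1, v2, v3, v4}. \<alpha> * y + poly u x = 0) \<and>
     u ^ 2 - [:\<alpha>:] ^ 2 * weierstrass A B =
       [:- fst v1, 1:] * [:- fst v2, 1:] * [:- fst v3, 1:] * [:- fst v4, 1:]"

text \<open>Regroups the zeros from P, Q | R, S to Q, R | P, S, the exchange on which associativity
  rests.\<close>

lemma quad_rotate: "quad A B \<alpha> u P Q R S \<longleftrightarrow> quad A B \<alpha> u Q R P S"
  unfolding quad_def by (simp only: mult_ac insert_commute)

lemma monic_quadratic:
  fixes p q \<alpha> :: "'a::field"
  assumes "degree l \<le> 1"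
  shows "degree ([:- p, 1:] * [:- q, 1:] - [:\<alpha>:] * l) = 2"
    "lead_coeff ([:- p, 1:] * [:- q, 1:] - [:\<alpha>:] * l) = 1"
proof -
  obtain c m where "l = [:c, m:]" using degree_le_1E[OF assms] .
  then have "[:- p, 1:] * [:- q, 1:] - [:\<alpha>:] * l = [:p * q - \<alpha> * c, - p - q - \<alpha> * m, 1:]"
    by simp
  then show "degree ([:- p, 1:] * [:- q, 1:] - [:\<alpha>:] * l) = 2"
    "lead_coeff ([:- p, 1:] * [:- q, 1:] - [:\<alpha>:] * l) = 1"
    by (simp_all only: degree_pCons_eq_if) simp_all
qed

text \<open>Here \<open>l1\<close> passes through P, Q, -D and \<open>l3\<close> through D, R, S.
  The first alternative occurs when the lines are mirror images, so that \<open>\<alpha> = 0\<close>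
  and R is -P or -Q.\<close>

lemma quad_if_collinear:
  fixes A B :: "'a::field"
  assumes c1: "collinear_at A B l1 p q d" and c3: "collinear_at A B l3 d r s"
    and dd: "poly l1 d = - poly l3 d"
  shows "(l3 = - l1 \<and> (r = p \<or> r = q)) \<or>
    (\<exists>\<alpha> u. quad A B \<alpha> u (p, poly l1 p) (q, poly l1 q) (r, poly l3 r) (s, poly l3 s))"
proof -
  define f a b e where "f = weierstrass A B" and "a = [:- p, 1:] * [:- q, 1:]"
    and "b = [:- r, 1:] * [:- s, 1:]" and "e = [:- d, 1:]"
  have e0: "e \<noteq> 0" by (simp add: e_def)
  have f1: "f - l1 ^ 2 = a * e" and f3: "f - l3 ^ 2 = e * b"
    using c1 c3 by (simp_all only: collinear_at_def f_def a_def b_def e_def mult_ac)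
  have deg: "degree l1 \<le> 1" "degree l3 \<le> 1" using c1 c3 by (auto simp: collinear_at_def)
  obtain m1 n1 where l1: "l1 = [:n1, m1:]" using degree_le_1E[OF deg(1)] .
  obtain m3 n3 where l3: "l3 = [:n3, m3:]" using degree_le_1E[OF deg(2)] .
  note l = l1 l3
  \<comment> \<open>\<open>l1 + l3\<close> has degree at most 1 and vanishes at \<open>d\<close>, so
    it is a constant multiple of \<open>e\<close>; \<open>-\<alpha>\<close> is that
    constant.\<close>
  define \<alpha> where "\<alpha> = - (m1 + m3)"
  have "n1 + n3 = \<alpha> * d" using dd unfolding l \<alpha>_def by (simp add: algebra_simps) algebra
  then have l13: "l1 + l3 = - ([:\<alpha>:] * e)" by (simp add: l e_def \<alpha>_def)
  have "e * (a - b) = e * ([:\<alpha>:] * (l1 - l3))"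
    using f1 f3 l13 by algebra
  then have ab: "a - b = [:\<alpha>:] * (l1 - l3)"
    by (rule mult_left_cancel[OF e0, THEN iffD1])
  show ?thesis
  proof (cases "\<alpha> = 0")
    case True
    then have "l3 = - l1" "a = b" using l13 ab by (simp_all add: eq_neg_iff_add_eq_0 add.commute)
    moreover have "(r - p) * (r - q) = poly a r" by (simp add: a_def algebra_simps)
    moreover have "poly a r = 0" unfolding \<open>a = b\<close> by (simp add: b_def)
    ultimately show ?thesis by simp
  next
    case False
    \<comment> \<open>Modulo \<open>y^2 = f\<close>, the product \<open>(y - l1) * (y - l3)\<close>
      equals \<open>e * (\<alpha> * y + a - \<alpha> * l1)\<close>; dividing by \<open>e\<close>
      leaves this \<open>u\<close>.\<close>
    define u where "u = a - [:\<alpha>:] * l1"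
    have u3: "u = b - [:\<alpha>:] * l3" using ab unfolding u_def by algebra
    have "u ^ 2 - [:\<alpha>:] ^ 2 * f = a * (a - 2 * [:\<alpha>:] * l1 - [:\<alpha>:] * ([:\<alpha>:] * e))"
      using f1 unfolding u_def by algebra
    also have "\<dots> = a * b"
      using l13 ab by algebra
    finally have "u ^ 2 - [:\<alpha>:] ^ 2 * f = a * b" .
    then have "u ^ 2 - [:\<alpha>:] ^ 2 * weierstrass A B =
        [:- p, 1:] * [:- q, 1:] * [:- r, 1:] * [:- s, 1:]"
      by (simp only: f_def a_def b_def mult_ac)
    moreover have "\<alpha> * poly l1 p + poly u p = 0" "\<alpha> * poly l1 q + poly u q = 0"
      by (simp_all add: u_def a_def)
    moreover have "\<alpha> * poly l3 r + poly u r = 0" "\<alpha> * poly l3 s + poly u s = 0"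
      by (simp_all add: u3 b_def)
    moreover have "degree u = 2" "lead_coeff u = 1"
      using monic_quadratic[OF deg(1)] unfolding u_def a_def by blast+
    ultimately have "quad A B \<alpha> u (p, poly l1 p) (q, poly l1 q) (r, poly l3 r) (s, poly l3 s)"
      using False by (simp add: quad_def)
    then show ?thesis by blast
  qed
qed

lemma monic_quadratic_eq:
  fixes w :: "'a::field poly"
  assumes "degree w = 2" "lead_coeff w = 1" "[:- p, 1:] * [:- q, 1:] dvd w"
  shows "w = [:- p, 1:] * [:- q, 1:]"
proof -
  obtain k where k: "w = [:- p, 1:] * [:- q, 1:] * k" using assms(3) by (elim dvdE)
  have "k \<noteq> 0" using assms k by auto
  then have "degree w = 2 + degree k" unfolding k by (subst degree_mult_eq) auto
  then have "degree k = 0" using assms by simp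
  then obtain c where "k = [:c:]" by (metis degree_0_id)
  moreover have "lead_coeff k = 1"
    using assms(2) unfolding k lead_coeff_mult by simp
  ultimately show ?thesis using k by simp
qed

text \<open>Restricting \<open>\<alpha> y + u\<close> to the line \<open>y = l1(x)\<close> gives a
  monic quadratic \<open>w\<close> with zeros \<open>p\<close> and \<open>q\<close>, so
  \<open>w = a\<close>. Cancelling \<open>a\<close> from the norm identity leaves the equation of
  the second line.\<close>

lemma collinear_if_quad:
  fixes A B :: "'a::field_char_0"
  assumes g: "quad A B \<alpha> u (p, poly l1 p) (q, poly l1 q) (r, yr) (s, ys)"
    and c1: "collinear_at A B l1 p q d"
    and nz: "p = q \<Longrightarrow> poly l1 p \<noteq> 0"
  shows "\<exists>l3. collinear_at A B l3 d r s \<and> poly l3 d = - poly l1 d \<and> yr = poly l3 r \<and> ys = poly l3 s"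
proof -
  define f a b e where "f = weierstrass A B" and "a = [:- p, 1:] * [:- q, 1:]"
    and "b = [:- r, 1:] * [:- s, 1:]" and "e = [:- d, 1:]"
  have \<alpha>: "\<alpha> \<noteq> 0" and u: "degree u = 2" "lead_coeff u = 1" using g by (auto simp: quad_def)
  have z: "\<alpha> * poly l1 p + poly u p = 0" "\<alpha> * poly l1 q + poly u q = 0"
     "\<alpha> * yr + poly u r = 0" "\<alpha> * ys + poly u s = 0"
    using g by (auto simp: quad_def)
  have f1: "f - l1 ^ 2 = a * e"
    using c1 by (simp only: collinear_at_def f_def a_def e_def mult_ac)
  have N: "u ^ 2 - [:\<alpha>:] ^ 2 * f = a * b"
    using g by (simp add: quad_def f_def a_def b_def mult_ac del: mult_pCons_left mult_pCons_right)
  have deg: "degree l1 \<le> 1" using c1 by (auto simp: collinear_at_def)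
  define w where "w = u + [:\<alpha>:] * l1"
  have prod: "w * (u - [:\<alpha>:] * l1) = a * (b + [:\<alpha>:] ^ 2 * e)"
    using f1 N unfolding w_def by algebra
  have "degree ([:\<alpha>:] * l1) < degree u" using deg u(1) by simp
  then have w2: "degree w = 2" "lead_coeff w = 1"
    using u unfolding w_def by (metis degree_add_eq_left, metis add.commute lead_coeff_add_le)
  have wpq: "poly w p = 0" "poly w q = 0" using z by (simp_all add: w_def algebra_simps)
  have "a dvd w"
  proof -
    obtain v where v: "w = [:- p, 1:] * v" using wpq(1) by (metis poly_eq_0_iff_dvd dvdE)
    have "poly v q = 0"
    proof (cases "p = q")
      case False
      then show ?thesis using wpq(2) by (simp add: v)
    next
      case True
      \<comment> \<open>For \<open>p = q\<close> evaluation yields only a simple zero of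
        \<open>w\<close>. The norm identity supplies the second one, since the conjugate factor is
        nonzero there by \<open>nz\<close>.\<close>
      have "[:- p, 1:] * (v * (u - [:\<alpha>:] * l1)) = [:- p, 1:] * ([:- q, 1:] * (b + [:\<alpha>:] ^ 2 * e))"
        using prod unfolding v a_def by (simp only: mult.assoc)
      then have "v * (u - [:\<alpha>:] * l1) = [:- q, 1:] * (b + [:\<alpha>:] ^ 2 * e)"
        by (subst (asm) mult_left_cancel) auto
      then have "poly (v * (u - [:\<alpha>:] * l1)) q = 0" by simp
      moreover have "poly (u - [:\<alpha>:] * l1) q = - 2 * \<alpha> * poly l1 q"
        using z(2) by (simp add: eq_neg_iff_add_eq_0 algebra_simps)
      moreover have "- 2 * \<alpha> * poly l1 q \<noteq> 0" using \<alpha> nz True by simp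
      ultimately show ?thesis by (simp only: poly_mult mult_eq_0_iff simp_thms)
    qed
    then show ?thesis unfolding v a_def by (intro mult_dvd_mono dvd_refl) (simp only: poly_eq_0_iff_dvd)
  qed
  then have w: "w = a" using monic_quadratic_eq[OF w2] unfolding a_def by blast
  then have "a * (u - [:\<alpha>:] * l1) = a * (b + [:\<alpha>:] ^ 2 * e)" using prod by simp
  moreover have "a \<noteq> 0" unfolding a_def by (metis mult_eq_0_iff pCons_eq_0_iff zero_neq_one)
  ultimately have ul: "u - [:\<alpha>:] * l1 = b + [:\<alpha>:] ^ 2 * e" by simp
  \<comment> \<open>This inverts the relation \<open>l1 + l3 = - \<alpha> * e\<close> of the forward
    direction.\<close>
  define l3 where "l3 = - (l1 + [:\<alpha>:] * e)"
  have "f - l3 ^ 2 = e * b"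
    using ul w f1 unfolding l3_def w_def by algebra
  moreover have "degree l3 \<le> 1"
  proof -
    have "degree (l1 + [:\<alpha>:] * e) \<le> 1"
      by (intro degree_add_le deg) (simp add: e_def)
    then show ?thesis unfolding l3_def by (simp only: degree_minus)
  qed
  ultimately have "collinear_at A B l3 d r s"
    by (simp only: collinear_at_def f_def b_def e_def mult_ac)
  moreover have "poly l3 d = - poly l1 d" by (simp add: l3_def e_def)
  moreover have "yr = poly l3 r" "ys = poly l3 s"
  proof -
    have u3: "u = b - [:\<alpha>:] * l3"
      using ul unfolding l3_def by algebra
    have "\<alpha> * yr = \<alpha> * poly l3 r" "\<alpha> * ys = \<alpha> * poly l3 s"
      using z(3,4) unfolding u3 by (simp_all add: b_def)
    then show "yr = poly l3 r" "ys = poly l3 s" using \<alpha> by simp_all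
  qed
  ultimately show ?thesis by blast
qed


lemma point_add_assoc:
  fixes A B :: "'a::field_char_0"
  assumes disc: "discriminant A B \<noteq> 0"
    and P: "P \<in> curve_points A B" and Q: "Q \<in> curve_points A B" and R: "R \<in> curve_points A B"
  shows "point_add A (point_add A P Q) R = point_add A P (point_add A Q R)"
proof -
  define D E S where "D = point_add A P Q" and "E = point_add A Q R" and "S = opp (point_add A D R)"
  have D: "D \<in> curve_points A B" and E: "E \<in> curve_points A B" and S: "S \<in> curve_points A B"
    unfolding D_def E_def S_def by (intro point_add_in_curve opp_in_curve P Q R)+
  have PQ: "sum_zero A B P Q (opp D)" and DR: "sum_zero A B D R S" and QR: "sum_zero A B Q R (opp E)"
    unfolding D_def E_def S_def by (intro sum_zero_add point_add_in_curve P Q R)+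
  have opp_r: "point_add A X (opp X) = Infinity" for X :: "'a point" by (cases X) auto
  have inf_r: "point_add A X Infinity = X" for X :: "'a point" by (cases X) auto
  have oppQ: "opp Q \<in> curve_points A B" using Q by (rule opp_in_curve)
  \<comment> \<open>The three cases in which two of the summands are opposite reduce to
    cancellation. They cover vertical lines through P, Q or Q, R and the exceptional alternative of
    \<open>quad_if_collinear\<close>.\<close>
  have R_oppQ: ?thesis if "R = opp Q"
    using point_add_opp_cancel[OF disc P Q] that by (simp add: opp_r inf_r)
  have R_oppP: ?thesis if "R = opp P"
    using point_add_opp_cancel[OF disc Q P] that point_add_comm[OF disc P Q]
      point_add_comm[OF disc P point_add_in_curve[OF Q opp_in_curve[OF P]]]
      point_add_opp_cancel[OF disc Q opp_in_curve[OF P]]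
    by simp
  have P_oppQ: ?thesis if "P = opp Q"
  proof -
    have "point_add A (opp Q) (point_add A Q R) = R"
      using point_add_opp_cancel[OF disc R Q] point_add_comm[OF disc Q R]
        point_add_comm[OF disc oppQ E] by (simp add: E_def)
    moreover have "point_add A (opp Q) Q = Infinity" using opp_r[of "opp Q"] by simp
    ultimately show ?thesis by (simp add: that)
  qed
  consider "P = Infinity \<or> Q = Infinity \<or> R = Infinity" | "D = Infinity" | "E = Infinity" | "S = Infinity"
    | "P \<noteq> Infinity" "Q \<noteq> Infinity" "R \<noteq> Infinity" "D \<noteq> Infinity" "E \<noteq> Infinity" "S \<noteq> Infinity"
    by blast
  then show ?thesis
  proof cases
    case 1
    then show ?thesis by (auto simp: inf_r)
  next
    case 2
    then have "P = opp Q" using PQ by (cases P; cases Q) auto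
    then show ?thesis by (rule P_oppQ)
  next
    case 3
    then have "R = opp Q" using QR by (cases R; cases Q) auto
    then show ?thesis by (rule R_oppQ)
  next
    case 4
    \<comment> \<open>Now P, Q, R themselves are collinear, so Q + R = -P and both sides are
      \<open>Infinity\<close>.\<close>
    then have "R = opp D" using DR by (cases R; cases D) auto
    with PQ have "sum_zero A B Q R P" by (metis sum_zero_perm)
    then have "E = opp P" using sum_zero_unique[OF disc _ Q R] by (simp add: E_def)
    then have "point_add A D R = point_add A P E" using \<open>R = opp D\<close> by (simp add: opp_r)
    then show ?thesis by (simp only: D_def E_def)
  next
    case 5
    then obtain p yp q yq r yr d yd e ye s ys where eqs:
      "P = Affine p yp" "Q = Affine q yq" "R = Affine r yr"
      "D = Affine d yd" "E = Affine e ye" "S = Affine s ys"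
      by (metis point.exhaust)
    obtain l1 where l1: "collinear_at A B l1 p q d" "yp = poly l1 p" "yq = poly l1 q" "- yd = poly l1 d"
      using PQ by (auto simp: eqs)
    obtain l3 where l3: "collinear_at A B l3 d r s" "yd = poly l3 d" "yr = poly l3 r" "ys = poly l3 s"
      using DR by (auto simp: eqs)
    obtain l2 where l2: "collinear_at A B l2 q r e" "yq = poly l2 q" "yr = poly l2 r" "- ye = poly l2 e"
      using QR by (auto simp: eqs)
    have "poly l1 d = - poly l3 d" using l1 l3 by simp
    from quad_if_collinear[OF l1(1) l3(1) this]
    consider "R = opp P" | "R = opp Q"
      | \<alpha> u where "quad A B \<alpha> u (p, yp) (q, yq) (r, yr) (s, ys)"
      using l1 l3 by (auto simp: eqs)
    then show ?thesis
    proof cases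
      case (3 \<alpha> u)
      then have "quad A B \<alpha> u (q, poly l2 q) (r, poly l2 r) (p, yp) (s, ys)"
        using l2 quad_rotate by blast
      \<comment> \<open>If \<open>q = r\<close> and the line vanishes there, then Q = R has order
        two and E would be \<open>Infinity\<close>.\<close>
      moreover have "poly l2 q \<noteq> 0" if "q = r"
      proof
        assume "poly l2 q = 0"
        then have "E = Infinity" using l2 that by (simp add: E_def eqs)
        then show False using eqs by simp
      qed
      ultimately obtain l4 where "collinear_at A B l4 e p s" "poly l4 e = - poly l2 e"
        "yp = poly l4 p" "ys = poly l4 s"
        using collinear_if_quad l2(1) by blast
      moreover from this have "ye = poly l4 e" using l2(4) by (metis minus_minus)
      ultimately have "sum_zero A B E P S" by (auto simp: eqs)
      then have "point_add A P E = opp S"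
        using sum_zero_unique[OF disc _ P E] sum_zero_perm(1) by blast
      then show ?thesis by (simp add: S_def flip: D_def E_def)
    qed (fact R_oppP R_oppQ)+
  qed
qed

section \<open>Multiples of a point\<close>

lemma Infinity_in_curve: "Infinity \<in> curve_points A B"
  by (simp add: curve_points_def)

lemma point_mult_in_curve:
  fixes A B :: "'a::field_char_0"
  shows "P \<in> curve_points A B \<Longrightarrow> point_mult A n P \<in> curve_points A B"
  by (induction n) (simp_all add: point_add_in_curve Infinity_in_curve)

lemma point_mult_add:
  fixes A B :: "'a::field_char_0"
  assumes "discriminant A B \<noteq> 0" "P \<in> curve_points A B"
  shows "point_mult A (m + n) P = point_add A (point_mult A m P) (point_mult A n P)"
  by (induction m) (use assms in \<open>simp_all add: point_add_assoc[OF assms(1)] point_mult_in_curve\<close>)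

lemma point_mult_power2_Suc:
  fixes A B :: "'a::field_char_0"
  assumes "discriminant A B \<noteq> 0" "P \<in> curve_points A B"
  shows "point_mult A (2 ^ Suc n) P = point_add A (point_mult A (2 ^ n) P) (point_mult A (2 ^ n) P)"
  using point_mult_add[OF assms, of "2 ^ n" "2 ^ n"] by (simp add: mult_2)

section \<open>Growth of the naive height under doubling\<close>

text \<open>Reducing a fraction can only shrink it: \<open>a * G = F * b\<close> with
  \<open>a\<close>, \<open>b\<close> coprime gives \<open>a dvd F\<close> and
  \<open>b dvd G\<close>. For \<open>F = 0\<close> divisibility bounds nothing, but then
  \<open>a = 0\<close>.\<close>

lemma quotient_of_abs_le:
  fixes F G :: int
  assumes "quotient_of x = (a, b)" "x = of_int F / of_int G" "G \<noteq> 0"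
  shows "\<bar>a\<bar> \<le> \<bar>F\<bar>" "\<bar>b\<bar> \<le> \<bar>G\<bar>"
proof -
  have b: "b > 0" and co: "coprime a b" and x: "x = of_int a / of_int b"
    using assms(1) quotient_of_denom_pos quotient_of_coprime quotient_of_div by blast+
  have "(of_int (a * G) :: rat) = of_int (F * b)"
    using x b assms by (simp add: field_simps)
  then have e: "a * G = F * b" by (simp only: of_int_eq_iff)
  then have "b dvd G" "a dvd F"
    using co by (metis coprime_dvd_mult_right_iff coprime_commute dvd_triv_right,
        metis coprime_dvd_mult_left_iff dvd_triv_left)
  moreover have "a = 0" if "F = 0" using e that assms(3) by simp
  ultimately show "\<bar>a\<bar> \<le> \<bar>F\<bar>" "\<bar>b\<bar> \<le> \<bar>G\<bar>"
    using assms(3) by (cases "F = 0"; simp add: dvd_imp_le_int)+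
qed

lemma naive_height_le:
  assumes "G \<noteq> 0" "\<bar>F\<bar> \<le> M" "\<bar>G\<bar> \<le> M"
  shows "naive_height (Affine (of_int F / of_int G) y) \<le> 1 / 2 * ln (real_of_int M)"
proof -
  obtain a b where ab: "quotient_of (of_int F / of_int G) = (a, b)" by fastforce
  have "b > 0" using ab quotient_of_denom_pos by blast
  then have "0 < max \<bar>a\<bar> \<bar>b\<bar>" by simp
  moreover have "max \<bar>a\<bar> \<bar>b\<bar> \<le> M"
    using quotient_of_abs_le[OF ab refl assms(1)] assms by simp
  ultimately have "ln (real_of_int (max \<bar>a\<bar> \<bar>b\<bar>)) \<le> ln (real_of_int M)"
    by (intro ln_mono) (simp_all only: of_int_le_iff of_int_0_less_iff)
  then show ?thesis by (simp add: ab)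
qed

lemma naive_height_nonneg: "naive_height P \<ge> 0"
proof (cases P)
  case (Affine x y)
  obtain a b where ab: "quotient_of x = (a, b)" by fastforce
  have "b > 0" using ab quotient_of_denom_pos by blast
  then have "1 \<le> max \<bar>a\<bar> \<bar>b\<bar>" by simp
  then show ?thesis using Affine ab by simp
qed simp

text \<open>\<open>C\<close> dominates the sums of the absolute coefficients of the two quartic
  forms in the duplication formula. Common factors of their values can only lower the
  height.\<close>

lemma naive_height_double_le:
  fixes A B C :: int
  assumes P: "P \<in> curve_points (of_int A) (of_int B)"
    and C: "1 + 2 * \<bar>A\<bar> + 8 * \<bar>B\<bar> + A ^ 2 \<le> C" "4 * (1 + \<bar>A\<bar> + \<bar>B\<bar>) \<le> C"
  shows "naive_height (point_add (of_int A) P P) \<le> 4 * naive_height P + 1 / 2 * ln (real_of_int C)"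
proof -
  have C1: "C \<ge> 1" by (rule order_trans[OF _ C(2)]) simp
  show ?thesis
  proof (cases "point_add (of_int A) P P = Infinity")
    case True
    \<comment> \<open>The height of \<open>Infinity\<close> is 0 by convention, and
      \<open>C >= 1\<close> makes the right side nonnegative.\<close>
    then show ?thesis using naive_height_nonneg[of P] C1 by simp
  next
    case False
    then obtain x y where Pxy: "P = Affine x y" and y: "y \<noteq> 0"
      by (cases P) (auto split: if_splits)
    obtain a b where ab: "quotient_of x = (a, b)" by fastforce
    have b: "b > 0" and x: "x = of_int a / of_int b"
      using ab quotient_of_denom_pos quotient_of_div by blast+
    define H where "H = max \<bar>a\<bar> \<bar>b\<bar>"
    have H: "\<bar>a\<bar> \<le> H" "\<bar>b\<bar> \<le> H" "H \<ge> 1" using b by (auto simp: H_def)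
    \<comment> \<open>\<open>F\<close> and \<open>G\<close> are the numerator
      \<open>x^4 - 2Ax^2 - 8Bx + A^2\<close> and the denominator \<open>4(x^3 + Ax + B)\<close> of
      x(2P), multiplied by \<open>b^4\<close>.\<close>
    define F where "F = a ^ 4 - 2 * A * a ^ 2 * b ^ 2 - 8 * B * a * b ^ 3 + A ^ 2 * b ^ 4"
    define G where "G = 4 * b * (a ^ 3 + A * a * b ^ 2 + B * b ^ 3)"
    have curve: "y ^ 2 = x ^ 3 + of_int A * x + of_int B"
      using P by (auto simp: Pxy curve_points_def)
    have bx: "of_int b * x = of_int a" using b x by simp
    have G: "of_int G = of_int b ^ 4 * (4 * y ^ 2)"
      unfolding curve G_def of_int_mult of_int_add of_int_power bx[symmetric] of_int_numeral by algebra
    then have G0: "G \<noteq> 0" using b y by auto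
    define m where "m = (3 * x ^ 2 + of_int A) / (2 * y)"
    have my: "m * (2 * y) = 3 * x ^ 2 + of_int A" using y by (simp add: m_def)
    have "4 * y ^ 2 * (m ^ 2 - x - x) = (m * (2 * y)) ^ 2 - 8 * x * y ^ 2" by algebra
    also have "\<dots> = x ^ 4 - 2 * of_int A * x ^ 2 - 8 * of_int B * x + of_int A ^ 2"
      unfolding my curve by algebra
    finally have dx: "4 * y ^ 2 * (m ^ 2 - x - x) =
      x ^ 4 - 2 * of_int A * x ^ 2 - 8 * of_int B * x + of_int A ^ 2" .
    have "of_int F = of_int b ^ 4 * (4 * y ^ 2 * (m ^ 2 - x - x))"
      unfolding dx F_def of_int_mult of_int_add of_int_diff of_int_power bx[symmetric] of_int_numeral
      by algebra
    then have "of_int F = of_int G * (m ^ 2 - x - x)" unfolding G by (simp only: mult.assoc)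
    then have "m ^ 2 - x - x = of_int F / of_int G" using G0 by simp
    then obtain y' where dbl: "point_add (of_int A) P P = Affine (of_int F / of_int G) y'"
      using y unfolding Pxy by (simp add: slope_def Let_def m_def)
    have pw: "\<bar>a\<bar> ^ i * \<bar>b\<bar> ^ j \<le> H ^ 4" if "i + j = 4" for i j
    proof -
      have "\<bar>a\<bar> ^ i * \<bar>b\<bar> ^ j \<le> H ^ i * H ^ j"
        using H by (intro mult_mono power_mono) auto
      then show ?thesis using that by (simp flip: power_add)
    qed
    have t: "\<bar>k * (a ^ i * b ^ j)\<bar> \<le> \<bar>k\<bar> * H ^ 4" if "i + j = 4" for i j k
      using mult_left_mono[OF pw[OF that], of "\<bar>k\<bar>"] by (simp add: abs_mult power_abs)
    have tri: "\<bar>w + x + y + z\<bar> \<le> \<bar>w\<bar> + \<bar>x\<bar> + \<bar>y\<bar> + \<bar>z\<bar>" for w x y z :: int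
      by linarith
    have "F = 1 * (a ^ 4 * b ^ 0) + (- 2 * A) * (a ^ 2 * b ^ 2) + (- 8 * B) * (a ^ 1 * b ^ 3)
        + A ^ 2 * (a ^ 0 * b ^ 4)"
      by (simp add: F_def mult.assoc)
    then have "\<bar>F\<bar> \<le> \<bar>1\<bar> * H ^ 4 + \<bar>- 2 * A\<bar> * H ^ 4 + \<bar>- 8 * B\<bar> * H ^ 4 + \<bar>A ^ 2\<bar> * H ^ 4"
      by (simp only:) (rule order_trans[OF tri], intro add_mono t; simp)
    also have "\<dots> = (1 + 2 * \<bar>A\<bar> + 8 * \<bar>B\<bar> + A ^ 2) * H ^ 4"
      by (simp add: abs_mult distrib_right)
    also have "\<dots> \<le> C * H ^ 4" using C(1) by (rule mult_right_mono) simp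
    finally have FM: "\<bar>F\<bar> \<le> C * H ^ 4" .
    \<comment> \<open>The zero summand pads \<open>G\<close> to four terms so that
      \<open>tri\<close> applies again.\<close>
    have "G = 4 * (a ^ 3 * b ^ 1) + (4 * A) * (a ^ 1 * b ^ 3) + (4 * B) * (a ^ 0 * b ^ 4) + 0 * (a ^ 0 * b ^ 4)"
      by (simp add: G_def distrib_left distrib_right mult_ac power2_eq_square power3_eq_cube power4_eq_xxxx)
    then have "\<bar>G\<bar> \<le> \<bar>4\<bar> * H ^ 4 + \<bar>4 * A\<bar> * H ^ 4 + \<bar>4 * B\<bar> * H ^ 4 + \<bar>0\<bar> * H ^ 4"
      by (simp only:) (rule order_trans[OF tri], intro add_mono t; simp)
    also have "\<dots> = 4 * (1 + \<bar>A\<bar> + \<bar>B\<bar>) * H ^ 4"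
      by (simp add: abs_mult distrib_right)
    also have "\<dots> \<le> C * H ^ 4" using C(2) by (rule mult_right_mono) simp
    finally have GM: "\<bar>G\<bar> \<le> C * H ^ 4" .
    have "naive_height (point_add (of_int A) P P) \<le> 1 / 2 * ln (real_of_int (C * H ^ 4))"
      unfolding dbl by (rule naive_height_le[OF G0 FM GM])
    also have "\<dots> = 4 * (1 / 2 * ln (real_of_int H)) + 1 / 2 * ln (real_of_int C)"
      using H(3) C1 by (simp add: ln_mult ln_realpow)
    also have "1 / 2 * ln (real_of_int H) = naive_height P"
      by (simp add: Pxy ab H_def)
    finally show ?thesis .
  qed
qed

section \<open>Bounding the canonical height by a term of the sequence\<close>

lemma lim_le_if_almost_quadratic:
  fixes h :: "nat \<Rightarrow> real"
  assumes nonneg: "\<And>n. h n \<ge> 0" and step: "\<And>n. h (Suc n) \<le> 4 * h n + c" and c: "c \<ge> 0"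
  shows "lim (\<lambda>n. h n / 4 ^ n) \<le> (h k + c / 3) / 4 ^ k"
proof -
  \<comment> \<open>The shift \<open>c / 3\<close> absorbs the error, as
    \<open>c + c / 3 = 4 * (c / 3)\<close>.\<close>
  define v where "v n = (h n + c / 3) / 4 ^ n" for n
  have dec: "decseq v"
  proof (rule decseq_SucI)
    show "v (Suc n) \<le> v n" for n
      using divide_right_mono[of "(h (Suc n) + c / 3) / 4" "h n + c / 3" "4 ^ n"] step[of n]
      by (simp add: v_def)
  qed
  moreover have "0 \<le> v n" for n using nonneg[of n] c by (simp add: v_def)
  ultimately obtain L where L: "v \<longlonglongrightarrow> L" "\<And>n. L \<le> v n"
    using decseq_convergent[of v 0] by blast
  have "(\<lambda>n. c / 3 * (1 / 4) ^ n) \<longlonglongrightarrow> 0"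
    by (intro tendsto_mult_right_zero LIMSEQ_power_zero) simp
  then have "(\<lambda>n. v n - c / 3 * (1 / 4) ^ n) \<longlonglongrightarrow> L - 0" by (intro tendsto_diff L)
  moreover have "v n - c / 3 * (1 / 4) ^ n = h n / 4 ^ n" for n
    by (simp add: v_def field_simps)
  ultimately have "(\<lambda>n. h n / 4 ^ n) \<longlonglongrightarrow> L" by simp
  then show ?thesis using L(2)[of k] by (simp add: limI v_def)
qed

lemma canonical_height_le:
  fixes A B C :: int
  assumes disc: "discriminant (of_int A :: rat) (of_int B) \<noteq> 0"
    and P: "P \<in> curve_points (of_int A) (of_int B)"
    and C: "1 + 2 * \<bar>A\<bar> + 8 * \<bar>B\<bar> + A ^ 2 \<le> C" "4 * (1 + \<bar>A\<bar> + \<bar>B\<bar>) \<le> C"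
  shows "canonical_height (of_int A) P \<le>
     (naive_height (point_mult (of_int A) (2 ^ k) P) + 1 / 6 * ln (real_of_int C)) / 4 ^ k"
proof -
  have "C \<ge> 1" by (rule order_trans[OF _ C(2)]) simp
  then have lnC: "0 \<le> 1 / 2 * ln (real_of_int C)" by simp
  have "naive_height (point_mult (of_int A) (2 ^ Suc n) P) \<le>
      4 * naive_height (point_mult (of_int A) (2 ^ n) P) + 1 / 2 * ln (real_of_int C)" for n
    unfolding point_mult_power2_Suc[OF disc P]
    by (rule naive_height_double_le[OF point_mult_in_curve[OF P] C])
  then have "lim (\<lambda>n. naive_height (point_mult (of_int A) (2 ^ n) P) / 4 ^ n) \<le>
      (naive_height (point_mult (of_int A) (2 ^ k) P) + 1 / 2 * ln (real_of_int C) / 3) / 4 ^ k"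
    using lnC by (intro lim_le_if_almost_quadratic naive_height_nonneg)
  \<comment> \<open>This serves the case \<open>P = Infinity\<close>, where the canonical height is
    0 by definition and not by the limit.\<close>
  moreover have "0 \<le> (naive_height (point_mult (of_int A) (2 ^ k) P) + 1 / 6 * ln (real_of_int C)) / 4 ^ k"
    using naive_height_nonneg[of "point_mult (of_int A) (2 ^ k) P"] lnC by simp
  ultimately show ?thesis
    unfolding canonical_height_def by (cases "P = Infinity") simp_all
qed

section \<open>The bounds for the two given points\<close>

theorem theorem2p2:
  fixes p q :: nat
  assumes "prime p" and "prime q" and "p > 5" and "q > 5"
    and "real p > 2 * root 4 2 * real q"
  shows "canonical_height (coeff_A p) (P1 q)
           \<le> 1 / 2 * ln (real p) + 1 / 24 * ln (2 ^ 11 * real p ^ 4) \<and>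
         canonical_height (coeff_A p) (P2 p q)
           \<le> 1 / 2 * ln (real p) + 1 / 6 * ln (2 ^ 11 * real p ^ 4)"
proof -
  define A B C :: int where "A = - (int p ^ 2)" and "B = int q ^ 2" and "C = 2 ^ 11 * int p ^ 4"
  have A: "of_int A = coeff_A p" and B: "of_int B = coeff_B q"
    by (simp_all add: A_def B_def coeff_A_def coeff_B_def)
  have disc: "discriminant (of_int A :: rat) (of_int B) \<noteq> 0"
    unfolding A B using assms(2,4) by (rule discriminant_nonzero)
  \<comment> \<open>The assumption on \<open>p\<close> enters as \<open>2 * q \<le> p\<close>, which
    bounds \<open>B\<close> by \<open>P\<close> and later makes the numerator of x(2P1)
    dominate.\<close>
  have "1 \<le> root 4 (2 :: real)" by simp
  then have "2 * real q \<le> 2 * root 4 2 * real q" by (simp add: mult_right_mono)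
  then have pq: "2 * q \<le> p" using assms(5) by linarith
  define P Q where "P = int p ^ 2" and "Q = int q ^ 2"
  have Q: "Q \<le> P" using pq by (simp add: P_def Q_def power_mono)
  have "1 ^ 2 \<le> int p ^ 2" using assms(3) by (intro power_mono) auto
  then have P: "1 \<le> P" by (simp add: P_def)
  then have PP: "P \<le> P ^ 2" by (simp add: self_le_power)
  have p4: "int p ^ 4 = P ^ 2" by (simp add: P_def flip: power_mult)
  \<comment> \<open>As \<open>1 \<le> P\<close>, \<open>Q \<le> P\<close> and
    \<open>P \<le> P^2\<close>, both left sides are at most \<open>12 * P^2\<close>, well below
    \<open>2048 * P^2\<close>.\<close>
  have C1: "1 + 2 * \<bar>A\<bar> + 8 * \<bar>B\<bar> + A ^ 2 \<le> C" and C2: "4 * (1 + \<bar>A\<bar> + \<bar>B\<bar>) \<le> C"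
  proof -
    have eqs: "\<bar>A\<bar> = P" "\<bar>B\<bar> = Q" "A ^ 2 = P ^ 2" "C = 2048 * P ^ 2"
      by (simp_all add: A_def B_def P_def Q_def) (simp add: C_def)
    show "1 + 2 * \<bar>A\<bar> + 8 * \<bar>B\<bar> + A ^ 2 \<le> C" "4 * (1 + \<bar>A\<bar> + \<bar>B\<bar>) \<le> C"
      unfolding eqs distrib_left by (insert P PP Q, linarith+)
  qed
  have lnC: "ln (real_of_int C) = ln (2 ^ 11 * real p ^ 4)" by (simp add: C_def)
  have curve: "P1 q \<in> curve_points (of_int A) (of_int B)" "P2 p q \<in> curve_points (of_int A) (of_int B)"
    unfolding A B by (rule P1_in_curve P2_in_curve)+

  have "naive_height (P2 p q) \<le> 1 / 2 * ln (real p)"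
    using naive_height_le[of 1 "- int p" "int p" "of_nat q"] assms(3) by (simp add: P2_def)
  moreover have "point_mult (of_int A) (2 ^ 0) (P2 p q) = P2 p q" by (simp add: P2_def)
  ultimately have 2: "canonical_height (coeff_A p) (P2 p q)
      \<le> 1 / 2 * ln (real p) + 1 / 6 * ln (2 ^ 11 * real p ^ 4)"
    using canonical_height_le[OF disc curve(2) C1 C2, of 0] by (simp add: A lnC)

  \<comment> \<open>The tangent slope at (0, q), where \<open>3 * x^2\<close> vanishes; hence x(2P1)
    is \<open>m^2\<close>.\<close>
  define m where "m = of_int A / (2 * of_nat q :: rat)"
  have "A ^ 2 = int p ^ 4" by (simp add: A_def flip: power_mult)
  then have "(of_int A :: rat) ^ 2 = of_int (int p ^ 4)" by (simp only: flip: of_int_power)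
  moreover have "(2 * of_nat q :: rat) ^ 2 = of_int (4 * int q ^ 2)" by (simp add: power_mult_distrib)
  ultimately have "m ^ 2 = of_int (int p ^ 4) / of_int (4 * int q ^ 2)"
    by (simp only: m_def power_divide)
  moreover have "point_mult (of_int A) (2 ^ 1) (P1 q) = Affine (m ^ 2) (m * (0 - m ^ 2) - of_nat q)"
    using assms(4) by (simp add: P1_def numeral_2_eq_2 slope_def Let_def m_def)
  ultimately obtain y where "point_mult (of_int A) (2 ^ 1) (P1 q) =
      Affine (of_int (int p ^ 4) / of_int (4 * int q ^ 2)) y"
    by simp
  moreover have "4 * int q ^ 2 \<le> int p ^ 4"
  proof -
    have "(2 * int q) ^ 2 \<le> int p ^ 2" using pq by (intro power_mono) auto
    then show ?thesis using PP unfolding p4 by (simp add: power_mult_distrib P_def)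
  qed
  ultimately have "naive_height (point_mult (of_int A) (2 ^ 1) (P1 q)) \<le> 1 / 2 * ln (real_of_int (int p ^ 4))"
    using naive_height_le[of "4 * int q ^ 2" "int p ^ 4" "int p ^ 4" y] assms(4) by simp
  also have "\<dots> = 2 * ln (real p)" using assms(3) by (simp add: ln_realpow)
  \<comment> \<open>With \<open>k = 1\<close> everything is divided by 4: \<open>2 * ln p\<close>
    becomes \<open>1/2 * ln p\<close>, and the factor 1/6 becomes 1/24.\<close>
  finally have "canonical_height (coeff_A p) (P1 q)
      \<le> 1 / 2 * ln (real p) + 1 / 24 * ln (2 ^ 11 * real p ^ 4)"
    using canonical_height_le[OF disc curve(1) C1 C2, of 1] by (simp add: A lnC)
  then show ?thesis using 2 ..
qed

end
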